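(* Let $A$ be a subring of $\mathbb{C}$ and let $f,g\in\mathcal{A}=1+zA[[z]]$. Then $$R(f\star g)\ge\tilde R(f)\cdot\tilde R(g).$$ In particular, the eñe product of two series with positive radius of convergence has positive radius of convergence.
   Context: $R(f)\in[0,+\infty]$ is the radius of convergence of $f$. The eñe radius of convergence is $\tilde R(f)=\min_i(|\alpha_i|,R(f))$, where $(\alpha_i)$ are the zeros of $f$ in its disk of convergence. (Convention: $0\cdot\infty=0$.) Eñe product: for $n\ge1$, let $Q_n\in\mathbb{Z}[X_1,\dots,X_n,Y_1,\dots,Y_n]$ be the unique polynomial such that in $\mathbb{Z}[x_1,\dots,x_n,y_1,\dots,y_n]$ the $n$-th elementary symmetric polynomial of the $n^2$ products $x_iy_j$ equals $Q_n(e_1(x),\dots,e_n(x),e_1(y),\dots,e_n(y))$, where $e_k$ are the elementary symmetric polynomials. For $f=1+\sum_{n\ge1}a_nz^n$ and $g=1+\sum_{n\ge1}b_nz^n$ in $\mathcal{A}$, $f\star g=1+\sum_{n\ge1}c_nz^n$ with $c_n=(-1)^nQ_n(a_1,\dots,a_n,b_1,\dots,b_n)$. *)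

theory Defs
  imports "HOL-Analysis.Analysis" "HOL-Library.Poly_Mapping"
begin

text \<open>
  Multivariate integer polynomials are finitely supported maps from monomials to
  coefficients, a monomial being a finitely supported map from variables to exponents.
\<close>

type_synonym 'v int_mpoly = "('v \<Rightarrow>\<^sub>0 nat) \<Rightarrow>\<^sub>0 int"

definition mvar :: "'v \<Rightarrow> 'v int_mpoly" where
  "mvar v = Poly_Mapping.single (Poly_Mapping.single v 1) 1"

definition mvars :: "'v int_mpoly \<Rightarrow> 'v set" where
  "mvars q = (\<Union>m\<in>Poly_Mapping.keys q. Poly_Mapping.keys m)"

definition minsert :: "('v \<Rightarrow> 'a::comm_ring_1) \<Rightarrow> 'v int_mpoly \<Rightarrow> 'a" where
  "minsert s q =
     (\<Sum>m\<in>Poly_Mapping.keys q. of_int (Poly_Mapping.lookup q m) *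
        (\<Prod>v\<in>Poly_Mapping.keys m. s v ^ Poly_Mapping.lookup m v))"

definition elem_sym :: "nat \<Rightarrow> 'i set \<Rightarrow> ('i \<Rightarrow> 'a::comm_ring_1) \<Rightarrow> 'a" where
  "elem_sym k I x = (\<Sum>S | S \<subseteq> I \<and> card S = k. \<Prod>i\<in>S. x i)"

text \<open>
  The variables \<open>Inl k\<close> and \<open>Inr k\<close> play the roles of \<open>X\<^sub>k\<close> and \<open>Y\<^sub>k\<close> in \<open>Q\<^sub>n\<close>, and of \<open>x\<^sub>k\<close>
  and \<open>y\<^sub>k\<close> in the ring in which the defining identity holds.
\<close>

definition is_ene_poly :: "nat \<Rightarrow> (nat + nat) int_mpoly \<Rightarrow> bool" where
  "is_ene_poly n q \<longleftrightarrow>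
     mvars q \<subseteq> Inl ` {1..n} \<union> Inr ` {1..n} \<and>
     elem_sym n ({1..n} \<times> {1..n})
         (\<lambda>(i, j). mvar (Inl i) * mvar (Inr j) :: (nat + nat) int_mpoly) =
       minsert (case_sum (\<lambda>k. elem_sym k {1..n} (\<lambda>i. mvar (Inl i)))
                         (\<lambda>k. elem_sym k {1..n} (\<lambda>j. mvar (Inr j)))) q"

definition ene_poly :: "nat \<Rightarrow> (nat + nat) int_mpoly" where
  "ene_poly n = (THE q. is_ene_poly n q)"

definition ene_prod :: "complex fps \<Rightarrow> complex fps \<Rightarrow> complex fps" (infixl \<open>\<star>\<close> 70) where
  "f \<star> g = Abs_fps (\<lambda>n. if n = 0 then 1
      else (-1) ^ n * minsert (case_sum (fps_nth f) (fps_nth g)) (ene_poly n))"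

definition complex_subring :: "complex set \<Rightarrow> bool" where
  "complex_subring A \<longleftrightarrow>
     1 \<in> A \<and> (\<forall>a\<in>A. \<forall>b\<in>A. a - b \<in> A) \<and> (\<forall>a\<in>A. \<forall>b\<in>A. a * b \<in> A)"

definition unit_series :: "complex set \<Rightarrow> complex fps set" where
  "unit_series A = {f. fps_nth f 0 = 1 \<and> (\<forall>n\<ge>1. fps_nth f n \<in> A)}"

text \<open>
  \<open>f\<close> may have infinitely many zeros in its disk of convergence, hence the infimum in place
  of \<open>Min\<close>; when \<open>f\<close> has constant term 1, they are isolated, so it is either \<open>fps_conv_radius f\<close>
  or attained at a zero. If there are no zeros, the inner infimum is \<open>\<infinity>\<close>.
\<close>

definition ene_radius :: "complex fps \<Rightarrow> ereal" where
  "ene_radius f = min (fps_conv_radius f)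
     (INF \<alpha> \<in> {\<alpha>. ereal (norm \<alpha>) < fps_conv_radius f \<and> eval_fps f \<alpha> = 0}. ereal (norm \<alpha>))"

end

theory Submission
  imports Defs "HOL-Complex_Analysis.Complex_Analysis"
    "HOL-Computational_Algebra.Fundamental_Theorem_Algebra"
    "HOL-Combinatorics.Transposition"
begin

text \<open>
  If \<open>f = \<Prod> (1 - c\<^sub>i z)\<close> and \<open>g = \<Prod> (1 - d\<^sub>j z)\<close>, then \<open>f \<star> g = \<Prod> (1 - c\<^sub>i d\<^sub>j z)\<close>. The coefficients
  of \<open>- z f' / f\<close> are the power sums of the \<open>c\<^sub>i\<close>, so \<open>\<star>\<close> multiplies these logarithmic derivatives
  coefficientwise, and since each coefficient involves only finitely many coefficients of \<open>f\<close>
  and \<open>g\<close>, this holds for all series. The series \<open>- z f' / f\<close> converges in the disk of radius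
  \<open>ene_radius f\<close>, radii of convergence multiply under the Hadamard product, and \<open>f \<star> g\<close> is recovered
  as the exponential of an integral.

  That \<open>Q\<^sub>n\<close> is well defined is proved on complex points: an integer polynomial is determined by
  its values there, and every complex tuple consists of the elementary symmetric functions of some
  other tuple. Existence is the fundamental theorem on symmetric polynomials, by induction on the
  number of variables \<open>s\<^sub>i\<close>: a symmetric function is a polynomial of degree below \<open>n\<close> in each
  single \<open>s\<^sub>i\<close>, with coefficients that depend only on the elementary symmetric functions, and a
  polynomial of degree below \<open>n\<close> taking the same value at \<open>n\<close> points is constant.
\<close>

subsection \<open>Elementary symmetric polynomials\<close>

lemma elem_sym_0 [simp]:
  assumes "finite I"
  shows "elem_sym 0 I x = 1"
proof -
  have "{S. S \<subseteq> I \<and> card S = 0} = {{}}"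
    using assms by (auto dest: finite_subset)
  then show ?thesis
    by (simp add: elem_sym_def)
qed

text \<open>Multiplying out means choosing the set of factors that contribute
  \<open>c * x i\<close>; these sets are then grouped by cardinality. Keeping \<open>u\<close> and
  \<open>c\<close> general covers the monic polynomial with prescribed roots, its value at one of
  the roots, and the power series with factors \<open>1 - c i * fps_X\<close>.\<close>

lemma prod_add_mult_elem_sym:
  fixes x :: "'i \<Rightarrow> 'a::comm_ring_1"
  assumes "finite I"
  shows "(\<Prod>i\<in>I. u + c * x i) = (\<Sum>k\<le>card I. elem_sym k I x * c ^ k * u ^ (card I - k))"
proof -
  have "(\<Prod>i\<in>I. u + c * x i) = (\<Sum>S\<in>Pow I. (\<Prod>i\<in>S. c * x i) * u ^ card (I - S))"
    using prod_add[OF assms, of "\<lambda>i. c * x i" "\<lambda>_. u"] by (simp add: add.commute)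
  also have "\<dots> = (\<Sum>S\<in>Pow I. (\<Prod>i\<in>S. x i) * c ^ card S * u ^ (card I - card S))"
    using assms by (intro sum.cong) (auto simp: prod.distrib card_Diff_subset finite_subset mult_ac)
  also have "\<dots> = (\<Sum>k\<le>card I. \<Sum>S\<in>{S. S \<in> Pow I \<and> card S = k}.
      (\<Prod>i\<in>S. x i) * c ^ card S * u ^ (card I - card S))"
    using assms by (intro sum.group [symmetric]) (auto intro: card_mono)
  also have "\<dots> = (\<Sum>k\<le>card I. elem_sym k I x * c ^ k * u ^ (card I - k))"
    by (auto simp: elem_sym_def sum_distrib_right intro!: sum.cong)
  finally show ?thesis .
qed

text \<open>The subsets of size \<open>Suc k\<close> split into those that avoid \<open>a\<close>
  and those that contain it.\<close>

lemma elem_sym_insert: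
  fixes x :: "'i \<Rightarrow> 'a::comm_ring_1"
  assumes "finite I" "a \<notin> I"
  shows "elem_sym (Suc k) (insert a I) x = elem_sym (Suc k) I x + x a * elem_sym k I x"
proof -
  let ?B = "{S. S \<subseteq> I \<and> card S = k}"
  have fin: "finite S" if "S \<subseteq> I" for S
    using assms that by (auto dest: finite_subset)
  have "{S. S \<subseteq> insert a I \<and> card S = Suc k} = {S. S \<subseteq> I \<and> card S = Suc k} \<union> insert a ` ?B"
    (is "?L = ?R")
  proof
    show "?L \<subseteq> ?R"
    proof
      fix S assume S: "S \<in> ?L"
      show "S \<in> ?R"
      proof (cases "a \<in> S")
        case True
        then have "S = insert a (S - {a})" "S - {a} \<in> ?B"
          using S assms by (auto dest: finite_subset)
        then show ?thesis by blast
      qed (use S in auto)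
    qed
    show "?R \<subseteq> ?L"
      using assms fin by (fastforce simp: card_insert_if)
  qed
  moreover have "{S. S \<subseteq> I \<and> card S = Suc k} \<inter> insert a ` ?B = {}"
    using assms by auto
  moreover have "inj_on (insert a) ?B"
    using assms by (intro inj_onI) (metis insert_ident mem_Collect_eq subsetD)
  moreover have "(\<Prod>i\<in>insert a S. x i) = x a * (\<Prod>i\<in>S. x i)" if "S \<in> ?B" for S
    using that assms fin by (subst prod.insert) auto
  ultimately show ?thesis
    using assms unfolding elem_sym_def
    by (simp add: sum.union_disjoint sum.reindex sum_distrib_left)
qed

lemma elem_sym_reindex:
  assumes "inj_on h I"
  shows "elem_sym k (h ` I) x = elem_sym k I (x \<circ> h)"
  unfolding elem_sym_def
proof (rule sum.reindex_bij_witness[of _ "\<lambda>S. h ` S" "\<lambda>S. I \<inter> h -` S"])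
  fix S assume "S \<in> {S. S \<subseteq> I \<and> card S = k}"
  then show "h ` S \<in> {S. S \<subseteq> h ` I \<and> card S = k}" "I \<inter> h -` h ` S = S"
    using assms by (auto simp: card_image inj_on_subset dest: inj_onD)
next
  fix S assume S: "S \<in> {S. S \<subseteq> h ` I \<and> card S = k}"
  then show eq: "h ` (I \<inter> h -` S) = S"
    by auto
  have inj: "inj_on h (I \<inter> h -` S)"
    using assms by (auto simp: inj_on_def)
  show "I \<inter> h -` S \<in> {S. S \<subseteq> I \<and> card S = k}"
    using S eq card_image[OF inj] by auto
  show "(\<Prod>i\<in>I \<inter> h -` S. (x \<circ> h) i) = (\<Prod>i\<in>S. x i)"
    by (subst (2) eq [symmetric]) (simp add: prod.reindex[OF inj])
qed

lemma elem_sym_permute: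
  assumes "bij_betw h I I"
  shows "elem_sym k I (x \<circ> h) = elem_sym k I x"
  using elem_sym_reindex[of h I k x] assms by (simp add: bij_betw_def)

lemma elem_sym_cong:
  assumes "\<And>i. i \<in> I \<Longrightarrow> x i = y i"
  shows "elem_sym k I x = elem_sym k I y"
  unfolding elem_sym_def using assms by (intro sum.cong prod.cong) auto

lemma sum_const_poly: "(\<Sum>i\<in>I. [:f i:]) = [:\<Sum>i\<in>I. f i:]"
  by (induction I rule: infinite_finite_induct) simp_all

lemma prod_const_poly: "(\<Prod>i\<in>I. [:f i :: 'a::comm_ring_1:]) = [:\<Prod>i\<in>I. f i:]"
  by (induction I rule: infinite_finite_induct) simp_all

text \<open>By the fundamental theorem of algebra, the monic polynomial whose lower coefficients are
  the \<open>a k\<close> splits into linear factors; the negated roots are the required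
  \<open>x\<close>.\<close>

lemma elem_sym_surj:
  fixes a :: "nat \<Rightarrow> complex"
  obtains x where "\<And>k. k \<in> {1..n} \<Longrightarrow> elem_sym k {1..n} x = a k"
proof -
  \<comment> \<open>The value \<open>a 0\<close> is arbitrary, so it is replaced by 1 to make
    \<open>p\<close> monic.\<close>
  define b where "b = (\<lambda>k. if k = 0 then 1 else a k)"
  define p where "p = (\<Sum>k\<le>n. monom (b k) (n - k))"
  have coeff_p: "poly.coeff p j = (if j \<le> n then b (n - j) else 0)" for j
  proof -
    have "poly.coeff p j = (\<Sum>k\<le>n. if k = n - j \<and> j \<le> n then b k else 0)"
      unfolding p_def coeff_sum by (intro sum.cong) auto
    then show ?thesis
      by auto
  qed
  have deg: "Polynomial.degree p = n"
    by (rule antisym[OF degree_le le_degree]) (auto simp: coeff_p b_def)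
  have "p \<noteq> 0" and lead: "lead_coeff p = 1"
    using coeff_p[of n] deg by (auto simp: b_def)
  then obtain A where "size A = n" "p = (\<Prod>x\<in>#A. [:-x, 1:])"
    using alg_closed_imp_factorization[of p] deg by auto
  moreover obtain xs where "mset xs = A"
    using ex_mset by blast
  ultimately have xs: "length xs = n" "p = (\<Prod>x\<leftarrow>xs. [:-x, 1:])"
    by (auto simp flip: prod_mset_prod_list)
  define x where "x = (\<lambda>i. - xs ! (i - 1))"
  have "p = (\<Prod>i<n. [:- xs ! i, 1:])"
    using xs by (simp add: prod.list_conv_set_nth atLeast0LessThan)
  \<comment> \<open>The values \<open>x i\<close> become constant polynomials, so that
    \<open>prod_add_mult_elem_sym\<close> applies in the polynomial ring with the indeterminate for
    \<open>u\<close>.\<close>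
  also have "\<dots> = (\<Prod>i\<in>{1..n}. monom 1 1 + 1 * [:x i:])"
    by (rule prod.reindex_bij_witness[of _ "\<lambda>i. i - 1" Suc]) (auto simp: x_def monom_altdef)
  also have "\<dots> = (\<Sum>k\<le>n. elem_sym k {1..n} (\<lambda>i. [:x i:]) * monom 1 (n - k))"
    by (subst prod_add_mult_elem_sym) (simp_all add: monom_power)
  also have "(\<lambda>k. elem_sym k {1..n} (\<lambda>i. [:x i:])) = (\<lambda>k. [:elem_sym k {1..n} x:])"
    by (simp add: elem_sym_def sum_const_poly prod_const_poly)
  finally have p_eq: "p = (\<Sum>k\<le>n. monom (elem_sym k {1..n} x) (n - k))"
    by (simp add: smult_monom)
  have "elem_sym k {1..n} x = a k" if "k \<in> {1..n}" for k
  proof -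
    have "poly.coeff p (n - k) = (\<Sum>j\<le>n. if j = k then elem_sym j {1..n} x else 0)"
      unfolding p_eq coeff_sum using that by (intro sum.cong) auto
    then show ?thesis
      using that by (auto simp: coeff_p b_def split: if_splits)
  qed
  then show ?thesis
    by (rule that)
qed

subsection \<open>Evaluation of integer polynomials\<close>

definition monom_val :: "('v \<Rightarrow> 'a::comm_ring_1) \<Rightarrow> ('v \<Rightarrow>\<^sub>0 nat) \<Rightarrow> 'a" where
  "monom_val s m = (\<Prod>v\<in>Poly_Mapping.keys m. s v ^ Poly_Mapping.lookup m v)"

lemma monom_val_superset:
  assumes "finite V" "Poly_Mapping.keys m \<subseteq> V"
  shows "monom_val s m = (\<Prod>v\<in>V. s v ^ Poly_Mapping.lookup m v)"
  unfolding monom_val_def using assms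
  by (intro prod.mono_neutral_left) (auto simp: in_keys_iff)

lemma monom_val_add: "monom_val s (m + m') = monom_val s m * monom_val s m'"
proof -
  let ?V = "Poly_Mapping.keys m \<union> Poly_Mapping.keys m'"
  have "monom_val s (m + m') = (\<Prod>v\<in>?V. s v ^ Poly_Mapping.lookup (m + m') v)"
    by (intro monom_val_superset keys_add) simp
  also have "\<dots> = (\<Prod>v\<in>?V. s v ^ Poly_Mapping.lookup m v) * (\<Prod>v\<in>?V. s v ^ Poly_Mapping.lookup m' v)"
    by (simp add: lookup_add power_add prod.distrib)
  finally show ?thesis
    using monom_val_superset[of ?V m s] monom_val_superset[of ?V m' s] by simp
qed

lemma minsert_superset:
  assumes "finite K" "Poly_Mapping.keys q \<subseteq> K"
  shows "minsert s q = (\<Sum>m\<in>K. of_int (Poly_Mapping.lookup q m) * monom_val s m)"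
  unfolding minsert_def monom_val_def using assms
  by (intro sum.mono_neutral_left) (auto simp: in_keys_iff)

lemma minsert_0 [simp]: "minsert s 0 = 0"
  by (simp add: minsert_def)

lemma minsert_add: "minsert s (p + q) = minsert s p + minsert s q"
proof -
  let ?K = "Poly_Mapping.keys p \<union> Poly_Mapping.keys q"
  have "minsert s (p + q) = (\<Sum>m\<in>?K. of_int (Poly_Mapping.lookup (p + q) m) * monom_val s m)"
    by (intro minsert_superset keys_add) simp
  then show ?thesis
    using minsert_superset[of ?K p s] minsert_superset[of ?K q s]
    by (simp add: lookup_add distrib_right sum.distrib)
qed

lemma minsert_sum: "minsert s (\<Sum>i\<in>I. p i) = (\<Sum>i\<in>I. minsert s (p i))"
  by (induction I rule: infinite_finite_induct) (simp_all add: minsert_add)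

lemma minsert_single: "minsert s (Poly_Mapping.single m a) = of_int a * monom_val s m"
  by (simp add: minsert_def monom_val_def)

lemma int_mpoly_eq_sum_single:
  fixes q :: "'v int_mpoly"
  shows "q = (\<Sum>m\<in>Poly_Mapping.keys q. Poly_Mapping.single m (Poly_Mapping.lookup q m))"
  by (rule poly_mapping_eqI)
    (simp add: lookup_sum lookup_single when_def in_keys_iff)

lemma minsert_mult: "minsert s (p * q) = minsert s p * minsert s q"
proof -
  let ?c = Poly_Mapping.lookup
  have "p * q = (\<Sum>m\<in>Poly_Mapping.keys p. \<Sum>m'\<in>Poly_Mapping.keys q.
      Poly_Mapping.single (m + m') (?c p m * ?c q m'))"
    by (subst int_mpoly_eq_sum_single[of p], subst int_mpoly_eq_sum_single[of q])
      (simp add: sum_product mult_single)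
  then show ?thesis
    by (simp add: minsert_sum minsert_single monom_val_add minsert_superset[of _ p, OF _ subset_refl]
        minsert_superset[of _ q, OF _ subset_refl] sum_product mult_ac)
qed

lemma of_int_mpoly_eq_single: "(of_int c :: 'v int_mpoly) = Poly_Mapping.single 0 c"
  by (metis of_int_eq_id id_apply single_of_int)

lemma minsert_of_int [simp]: "minsert s (of_int c) = of_int c"
  by (simp add: of_int_mpoly_eq_single minsert_single monom_val_def del: single_of_int)

lemma minsert_1 [simp]: "minsert s 1 = 1"
  using minsert_of_int[of s 1] by simp

lemma minsert_prod: "minsert s (\<Prod>i\<in>I. p i) = (\<Prod>i\<in>I. minsert s (p i))"
  by (induction I rule: infinite_finite_induct) (simp_all add: minsert_mult)

lemma minsert_power: "minsert s (p ^ k) = minsert s p ^ k"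
  by (induction k) (simp_all add: minsert_mult)

lemma minsert_mvar [simp]: "minsert s (mvar v) = s v"
  by (simp add: mvar_def minsert_single monom_val_def)

lemma minsert_elem_sym: "minsert s (elem_sym k I p) = elem_sym k I (\<lambda>i. minsert s (p i))"
  by (simp add: elem_sym_def minsert_sum minsert_prod)

text \<open>Substitutions compose. This turns the formal identity defining
  \<open>is_ene_poly\<close> into an identity between complex values.\<close>

lemma minsert_minsert: "minsert s (minsert t q) = minsert (\<lambda>v. minsert s (t v)) q"
  by (simp add: minsert_def[of _ q] minsert_sum minsert_mult minsert_prod minsert_power)

lemma minsert_cong:
  assumes "\<And>v. v \<in> mvars q \<Longrightarrow> s v = t v"
  shows "minsert s q = minsert t q"
  using assms unfolding minsert_def mvars_def
  by (intro sum.cong prod.cong refl arg_cong2[where f = "(*)"] arg_cong2[where f = "(^)"]) auto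

lemma mvars_add: "mvars (p + q) \<subseteq> mvars p \<union> mvars q"
  using keys_add[of p q] by (auto simp: mvars_def)

lemma mvars_mult: "mvars (p * q) \<subseteq> mvars p \<union> mvars q"
proof
  fix v assume "v \<in> mvars (p * q)"
  then obtain a b where "a \<in> Poly_Mapping.keys p" "b \<in> Poly_Mapping.keys q"
    "v \<in> Poly_Mapping.keys (a + b)"
    using keys_mult[of p q] by (auto simp: mvars_def)
  then show "v \<in> mvars p \<union> mvars q"
    using keys_add[of a b] by (auto simp: mvars_def)
qed

lemma mvars_mvar: "mvars (mvar v) = {v}"
  by (simp add: mvars_def mvar_def)

lemma mvars_of_int: "mvars (of_int c) = {}"
  by (simp add: of_int_mpoly_eq_single mvars_def del: single_of_int)

text \<open>With all variables but \<open>x\<close> fixed, the relation is a polynomial in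
  \<open>s x\<close> that vanishes everywhere. Its coefficient at exponent \<open>e m x\<close> is a
  relation in the remaining variables, over those indices that agree with \<open>m\<close> at
  \<open>x\<close>. Exponents are given by a function \<open>e\<close> on an abstract index set, so
  that variables can be removed without changing the indices.\<close>

lemma power_products_linear_independent:
  fixes a :: "'k \<Rightarrow> complex" and e :: "'k \<Rightarrow> 'v \<Rightarrow> nat"
  assumes "finite V" "finite K"
    and "\<And>m m'. m \<in> K \<Longrightarrow> m' \<in> K \<Longrightarrow> (\<And>v. v \<in> V \<Longrightarrow> e m v = e m' v) \<Longrightarrow> m = m'"
    and "\<And>s. (\<Sum>m\<in>K. a m * (\<Prod>v\<in>V. s v ^ e m v)) = 0"
    and "m \<in> K"
  shows "a m = 0"
  using assms
proof (induction V arbitrary: K m rule: finite_induct)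
  case empty
  then have "K = {m}" by auto
  then show ?case using empty.prems(3) by simp
next
  case (insert x V)
  let ?K = "{k \<in> K. e k x = e m x}"
  show ?case
  proof (rule insert.IH[of ?K])
    fix s :: "'v \<Rightarrow> complex"
    define p where "p = (\<Sum>k\<in>K. Polynomial.monom (a k * (\<Prod>v\<in>V. s v ^ e k v)) (e k x))"
    have "poly p z = 0" for z
    proof -
      have "poly p z = (\<Sum>k\<in>K. a k * (\<Prod>v\<in>insert x V. (s(x := z)) v ^ e k v))"
        unfolding p_def poly_sum
      proof (intro sum.cong refl)
        fix k
        have "(\<Prod>v\<in>V. (s(x := z)) v ^ e k v) = (\<Prod>v\<in>V. s v ^ e k v)"
          using insert.hyps by (intro prod.cong) auto
        then show "poly (Polynomial.monom (a k * (\<Prod>v\<in>V. s v ^ e k v)) (e k x)) z =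
            a k * (\<Prod>v\<in>insert x V. (s(x := z)) v ^ e k v)"
          using insert.hyps by (simp add: poly_monom mult_ac)
      qed
      then show ?thesis using insert.prems(3) by simp
    qed
    then have "p = 0"
      by (simp flip: poly_all_0_iff_0)
    then have "poly.coeff p (e m x) = 0"
      by simp
    also have "poly.coeff p (e m x) = (\<Sum>k\<in>?K. a k * (\<Prod>v\<in>V. s v ^ e k v))"
      using insert.prems(1) by (auto simp: p_def coeff_sum sum.If_cases Int_def)
    finally show "(\<Sum>k\<in>?K. a k * (\<Prod>v\<in>V. s v ^ e k v)) = 0" .
  next
    fix k k' assume "k \<in> ?K" "k' \<in> ?K" "\<And>v. v \<in> V \<Longrightarrow> e k v = e k' v"
    then show "k = k'" by (intro insert.prems(2)) auto
  qed (use insert.prems in auto)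
qed

lemma int_mpoly_eqI:
  fixes p q :: "'v int_mpoly"
  assumes "\<And>s :: 'v \<Rightarrow> complex. minsert s p = minsert s q"
  shows "p = q"
proof (rule poly_mapping_eqI)
  fix m
  \<comment> \<open>Inserting \<open>m\<close> covers the case that it occurs in neither polynomial.
    The set \<open>V\<close> contains all variables of monomials in \<open>K\<close>, so distinct
    elements of \<open>K\<close> differ on \<open>V\<close>.\<close>
  define K where "K = insert m (Poly_Mapping.keys p \<union> Poly_Mapping.keys q)"
  define V where "V = \<Union> (Poly_Mapping.keys ` K)"
  define a :: "('v \<Rightarrow>\<^sub>0 nat) \<Rightarrow> complex"
    where "a = (\<lambda>k. of_int (Poly_Mapping.lookup p k) - of_int (Poly_Mapping.lookup q k))"
  have fin: "finite K" "finite V"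
    by (simp_all add: K_def V_def)
  have "a m = 0"
  proof (rule power_products_linear_independent[OF fin(2) fin(1)])
    fix k k' assume k: "k \<in> K" "k' \<in> K"
      "\<And>v. v \<in> V \<Longrightarrow> Poly_Mapping.lookup k v = Poly_Mapping.lookup k' v"
    have "Poly_Mapping.lookup k v = Poly_Mapping.lookup k' v" if "v \<notin> V" for v
      using that k(1,2) by (auto simp: V_def in_keys_iff)
    with k(3) show "k = k'"
      by (intro poly_mapping_eqI) blast
  next
    fix s :: "'v \<Rightarrow> complex"
    have "0 = minsert s p - minsert s q"
      using assms by simp
    also have "\<dots> = (\<Sum>k\<in>K. a k * monom_val s k)"
      using minsert_superset[of K p s] minsert_superset[of K q s] fin
      by (simp add: a_def K_def left_diff_distrib sum_subtractf Un_upper1 Un_upper2 subset_insertI2)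
    also have "\<dots> = (\<Sum>k\<in>K. a k * (\<Prod>v\<in>V. s v ^ Poly_Mapping.lookup k v))"
      using fin by (intro sum.cong refl arg_cong2[where f = "(*)"] monom_val_superset) (auto simp: V_def)
    finally show "(\<Sum>k\<in>K. a k * (\<Prod>v\<in>V. s v ^ Poly_Mapping.lookup k v)) = 0" by simp
  qed (simp add: K_def)
  then show "Poly_Mapping.lookup p m = Poly_Mapping.lookup q m"
    by (simp add: a_def)
qed

subsection \<open>Symmetric integer polynomial functions\<close>

text \<open>Integer polynomials in the variables \<open>V\<close>, as functions on complex points.
  Working with functions allows existence to be argued by closure properties and evaluation;
  \<open>int_poly_fun_imp_minsert\<close> leads back to formal polynomials.\<close>

inductive_set int_poly_fun :: "'v set \<Rightarrow> (('v \<Rightarrow> complex) \<Rightarrow> complex) set" for V where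
  const: "(\<lambda>s. of_int c) \<in> int_poly_fun V"
| var: "v \<in> V \<Longrightarrow> (\<lambda>s. s v) \<in> int_poly_fun V"
| add: "F \<in> int_poly_fun V \<Longrightarrow> G \<in> int_poly_fun V \<Longrightarrow> (\<lambda>s. F s + G s) \<in> int_poly_fun V"
| mult: "F \<in> int_poly_fun V \<Longrightarrow> G \<in> int_poly_fun V \<Longrightarrow> (\<lambda>s. F s * G s) \<in> int_poly_fun V"

lemma int_poly_fun_0: "(\<lambda>s. 0) \<in> int_poly_fun V"
  using int_poly_fun.const[of 0 V] by simp

lemma int_poly_fun_1: "(\<lambda>s. 1) \<in> int_poly_fun V"
  using int_poly_fun.const[of 1 V] by simp

lemma int_poly_fun_minus: "F \<in> int_poly_fun V \<Longrightarrow> (\<lambda>s. - F s) \<in> int_poly_fun V"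
  using int_poly_fun.mult[OF int_poly_fun.const[of "-1"]] by simp

lemma int_poly_fun_diff:
  "F \<in> int_poly_fun V \<Longrightarrow> G \<in> int_poly_fun V \<Longrightarrow> (\<lambda>s. F s - G s) \<in> int_poly_fun V"
  using int_poly_fun.add[OF _ int_poly_fun_minus] by simp

lemma int_poly_fun_sum:
  "(\<And>i. i \<in> I \<Longrightarrow> F i \<in> int_poly_fun V) \<Longrightarrow> (\<lambda>s. \<Sum>i\<in>I. F i s) \<in> int_poly_fun V"
  by (induction I rule: infinite_finite_induct)
    (auto intro: int_poly_fun_0 int_poly_fun.add)

lemma int_poly_fun_prod:
  "(\<And>i. i \<in> I \<Longrightarrow> F i \<in> int_poly_fun V) \<Longrightarrow> (\<lambda>s. \<Prod>i\<in>I. F i s) \<in> int_poly_fun V"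
  by (induction I rule: infinite_finite_induct)
    (auto intro: int_poly_fun_1 int_poly_fun.mult)

lemma int_poly_fun_comp:
  assumes "F \<in> int_poly_fun V" "\<And>v. v \<in> V \<Longrightarrow> (\<lambda>s. \<sigma> s v) \<in> int_poly_fun W"
  shows "(\<lambda>s. F (\<sigma> s)) \<in> int_poly_fun W"
  using assms(1) by induction (simp_all add: int_poly_fun.intros assms(2))

lemma int_poly_fun_cong:
  assumes "F \<in> int_poly_fun V" "\<And>v. v \<in> V \<Longrightarrow> s v = t v"
  shows "F s = F t"
  using assms(1) by induction (auto simp: assms(2))

lemma int_poly_fun_continuous:
  assumes "F \<in> int_poly_fun V" "\<And>v. v \<in> V \<Longrightarrow> continuous_on A (\<lambda>t. \<gamma> t v)"
  shows "continuous_on A (\<lambda>t. F (\<gamma> t))"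
  using assms(1) by induction (simp_all add: assms(2) continuous_on_add continuous_on_mult)

lemma int_poly_fun_imp_minsert:
  assumes "F \<in> int_poly_fun V"
  obtains q where "mvars q \<subseteq> V" "F = (\<lambda>s. minsert s q)"
proof -
  have "\<exists>q. mvars q \<subseteq> V \<and> F = (\<lambda>s. minsert s q)"
    using assms
  proof induction
    case (const c)
    then show ?case
      by (intro exI[of _ "of_int c"]) (simp add: mvars_of_int)
  next
    case (var v)
    then show ?case
      by (intro exI[of _ "mvar v"]) (simp add: mvars_mvar)
  next
    case (add F G)
    then obtain p q where "mvars p \<subseteq> V" "F = (\<lambda>s. minsert s p)" "mvars q \<subseteq> V" "G = (\<lambda>s. minsert s q)"
      by blast
    then show ?case
      using mvars_add[of p q] by (intro exI[of _ "p + q"]) (auto simp: minsert_add)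
  next
    case (mult F G)
    then obtain p q where "mvars p \<subseteq> V" "F = (\<lambda>s. minsert s p)" "mvars q \<subseteq> V" "G = (\<lambda>s. minsert s q)"
      by blast
    then show ?case
      using mvars_mult[of p q] by (intro exI[of _ "p * q"]) (auto simp: minsert_mult)
  qed
  then show ?thesis
    using that by blast
qed

text \<open>A density argument: the points \<open>s v + t * of_nat (\<iota> v)\<close> are injective
  on \<open>I\<close> for all but finitely many \<open>t\<close>, and both sides are continuous at
  \<open>t = 0\<close>.\<close>

lemma int_poly_fun_eqI_inj:
  assumes "F \<in> int_poly_fun V" "G \<in> int_poly_fun V" "finite I"
    and eq: "\<And>s. inj_on s I \<Longrightarrow> F s = G s"
  shows "F s = G s"
proof -
  obtain \<iota> :: "'a \<Rightarrow> nat" where \<iota>: "inj_on \<iota> I"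
    using finite_imp_inj_to_nat_seg[OF \<open>finite I\<close>] by blast
  define \<gamma> where "\<gamma> = (\<lambda>(t::complex) v. s v + t * of_nat (\<iota> v))"
  \<comment> \<open>The parameters at which two coordinates can collide. Pairs with
    \<open>i = j\<close> contribute 0 / 0 = 0, which is harmless because the limit at 0 disregards
    \<open>t = 0\<close>.\<close>
  define B where "B = (\<lambda>(i, j). (s j - s i) / (of_nat (\<iota> i) - of_nat (\<iota> j))) ` (I \<times> I)"
  have inj: "inj_on (\<gamma> t) I" if "t \<notin> B" for t
  proof (rule inj_onI, rule ccontr)
    fix i j assume ij: "i \<in> I" "j \<in> I" "\<gamma> t i = \<gamma> t j" "i \<noteq> j"
    then have "\<iota> i \<noteq> \<iota> j"
      using \<iota> by (auto dest: inj_onD)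
    then have "t = (s j - s i) / (of_nat (\<iota> i) - of_nat (\<iota> j))"
      using ij(3) by (simp add: \<gamma>_def field_simps)
    then show False
      using that ij by (auto simp: B_def)
  qed
  have "finite B"
    using \<open>finite I\<close> by (simp add: B_def)
  then have "eventually (\<lambda>t. t \<notin> B) (at 0)"
    using islimpt_finite islimpt_iff_eventually by blast
  then have ev: "eventually (\<lambda>t. F (\<gamma> t) - G (\<gamma> t) = 0) (at 0)"
    by eventually_elim (simp add: eq inj)
  have "continuous_on UNIV (\<lambda>t. F (\<gamma> t) - G (\<gamma> t))"
    unfolding \<gamma>_def
    by (intro continuous_on_diff int_poly_fun_continuous[OF assms(1)]
        int_poly_fun_continuous[OF assms(2)] continuous_intros)
  then have "((\<lambda>t. F (\<gamma> t) - G (\<gamma> t)) \<longlongrightarrow> F (\<gamma> 0) - G (\<gamma> 0)) (at 0)"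
    by (simp add: continuous_on_def)
  moreover have "((\<lambda>t. F (\<gamma> t) - G (\<gamma> t)) \<longlongrightarrow> 0) (at 0)"
    using ev by (rule tendsto_eventually)
  ultimately have "F (\<gamma> 0) - G (\<gamma> 0) = 0"
    by (rule tendsto_unique[rotated]) simp
  then show ?thesis
    by (simp add: \<gamma>_def)
qed

text \<open>The value \<open>s x\<close> is a root of the monic polynomial with roots
  \<open>s i\<close>, and the equation is solved for its leading power.\<close>

lemma power_card_eq_elem_sym:
  fixes s :: "'v \<Rightarrow> complex"
  assumes "finite I" "x \<in> I" "card I = Suc n"
  shows "s x ^ Suc n = (\<Sum>j\<le>n. (- 1) ^ (n - j) * elem_sym (Suc n - j) I s * s x ^ j)"
proof -
  have "0 = (\<Prod>i\<in>I. s x + (- 1) * s i)"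
    using assms by (simp add: prod_zero_iff) auto
  also have "\<dots> = (\<Sum>k\<le>Suc n. elem_sym k I s * (- 1) ^ k * s x ^ (Suc n - k))"
    using prod_add_mult_elem_sym[OF assms(1), of "s x" "-1" s] assms(3) by simp
  also have "\<dots> = s x ^ Suc n + (\<Sum>k\<le>n. elem_sym (Suc k) I s * (- 1) ^ Suc k * s x ^ (n - k))"
    using assms(1) by (subst sum.atMost_Suc_shift) simp
  also have "(\<Sum>k\<le>n. elem_sym (Suc k) I s * (- 1) ^ Suc k * s x ^ (n - k)) =
      (\<Sum>j\<le>n. - ((- 1) ^ (n - j) * elem_sym (Suc n - j) I s * s x ^ j))"
    by (rule sum.reindex_bij_witness[of _ "\<lambda>j. n - j" "\<lambda>j. n - j"]) (auto simp: Suc_diff_le)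
  finally show ?thesis
    by (simp add: sum_negf)
qed

text \<open>
  Reduction modulo the monic polynomial with roots \<open>s i\<close>, \<open>i \<in> I\<close>: the coefficients of the
  remainder only involve elementary symmetric polynomials and the parameters \<open>P\<close>.
\<close>
lemma int_poly_fun_reduce:
  fixes x :: 'v
  assumes I: "finite I" "x \<in> I" "card I = Suc n"
    and H: "H \<in> int_poly_fun (Inl ` {1..Suc n} \<union> Inr ` insert x P)"
  defines "E \<equiv> \<lambda>s. case_sum (\<lambda>k. elem_sym k I s) s"
  obtains c where "\<And>k. c k \<in> int_poly_fun (Inl ` {1..Suc n} \<union> Inr ` P)"
    "\<And>s. H (E s) = (\<Sum>k\<le>n. c k (E s) * s x ^ k)"
proof -
  let ?R = "int_poly_fun (Inl ` {1..Suc n} \<union> Inr ` P)"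
  \<comment> \<open>The functions that have the desired normal form. It remains to see that they are
    closed under the operations generating \<open>int_poly_fun\<close>; multiplication by
    \<open>s x\<close> is the essential case.\<close>
  define M where "M = {h. \<exists>c. (\<forall>k. c k \<in> ?R) \<and> h = (\<lambda>s. \<Sum>k\<le>n. c k (E s) * s x ^ k)}"
  have M_add: "(\<lambda>s. h s + h' s) \<in> M" if mem: "h \<in> M" "h' \<in> M" for h h'
  proof -
    obtain c c' where "\<And>k. c k \<in> ?R" "\<And>k. c' k \<in> ?R"
      and h: "h = (\<lambda>s. \<Sum>k\<le>n. c k (E s) * s x ^ k)" "h' = (\<lambda>s. \<Sum>k\<le>n. c' k (E s) * s x ^ k)"
      using mem unfolding M_def by blast
    then have "\<And>k. (\<lambda>t. c k t + c' k t) \<in> ?R"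
      by (intro int_poly_fun.add)
    then show ?thesis unfolding M_def
      by (intro CollectI exI[of _ "\<lambda>k t. c k t + c' k t"])
        (simp add: h sum.distrib distrib_right)
  qed
  have M_coeff: "(\<lambda>s. d (E s) * h s) \<in> M" if mem: "d \<in> ?R" "h \<in> M" for d h
  proof -
    obtain c where "\<And>k. c k \<in> ?R" and h: "h = (\<lambda>s. \<Sum>k\<le>n. c k (E s) * s x ^ k)"
      using mem unfolding M_def by blast
    then have "\<And>k. (\<lambda>t. d t * c k t) \<in> ?R"
      using mem by (intro int_poly_fun.mult)
    then show ?thesis unfolding M_def
      by (intro CollectI exI[of _ "\<lambda>k t. d t * c k t"])
        (simp add: h sum_distrib_left mult.assoc)
  qed
  have M_sum: "(\<lambda>s. \<Sum>k\<le>(N::nat). h k s) \<in> M" if "\<And>k. h k \<in> M" for h N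
    by (induction N) (simp_all add: that M_add)
  have M_1: "(\<lambda>s. 1) \<in> M"
  proof -
    have "(\<lambda>s::'v \<Rightarrow> complex. 1 :: complex) = (\<lambda>s. \<Sum>k\<le>n. (if k = 0 then 1 else 0) * s x ^ k)"
      by (rule ext) (simp add: sum.atMost_shift)
    then show ?thesis unfolding M_def
      by (intro CollectI exI[of _ "\<lambda>k t. if k = 0 then 1 else 0"])
        (auto simp: int_poly_fun_0 int_poly_fun_1)
  qed
  have M_x: "(\<lambda>s. s x * h s) \<in> M" if mem: "h \<in> M" for h
  proof -
    obtain c where c: "\<And>k. c k \<in> ?R" and h: "h = (\<lambda>s. \<Sum>k\<le>n. c k (E s) * s x ^ k)"
      using mem unfolding M_def by blast
    define c' where "c' = (\<lambda>k t. (if k = 0 then 0 else c (k - 1) t) +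
      c n t * ((- 1) ^ (n - k) * (if k \<le> n then t (Inl (Suc n - k)) else 0)))"
    have "(\<lambda>t. if k = 0 then 0 else c (k - 1) t) \<in> ?R" for k
      using c by (cases "k = 0") (simp_all add: int_poly_fun_0)
    moreover have "(\<lambda>t. (- 1) ^ (n - k)) \<in> ?R" for k
      using int_poly_fun.const[of "(- 1) ^ (n - k)"] by simp
    moreover have "(\<lambda>t. if k \<le> n then t (Inl (Suc n - k)) else 0) \<in> ?R" for k
      by (cases "k \<le> n") (auto simp: int_poly_fun_0 intro!: int_poly_fun.var)
    ultimately have "c' k \<in> ?R" for k
      unfolding c'_def using c by (intro int_poly_fun.add int_poly_fun.mult)
    moreover have "s x * h s = (\<Sum>k\<le>n. c' k (E s) * s x ^ k)" for s
    proof -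
      have "s x * h s = (\<Sum>k\<le>n. c k (E s) * s x ^ Suc k)"
        by (simp add: h sum_distrib_left mult_ac)
      also have "\<dots> = (\<Sum>k<n. c k (E s) * s x ^ Suc k) + c n (E s) * s x ^ Suc n"
        by (simp flip: lessThan_Suc_atMost)
      also have "(\<Sum>k<n. c k (E s) * s x ^ Suc k) =
          (\<Sum>k\<le>n. (if k = 0 then 0 else c (k - 1) (E s)) * s x ^ k)"
        by (simp add: sum.atMost_shift)
      also have "c n (E s) * s x ^ Suc n =
          (\<Sum>k\<le>n. c n (E s) * ((- 1) ^ (n - k) * (if k \<le> n then E s (Inl (Suc n - k)) else 0)) * s x ^ k)"
        unfolding power_card_eq_elem_sym[OF I]
        by (simp add: E_def sum_distrib_left mult_ac)
      finally show ?thesis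
        by (simp add: c'_def distrib_right sum.distrib)
    qed
    ultimately show ?thesis
      unfolding M_def by (intro CollectI exI[of _ c'] conjI allI ext)
  qed
  have M_x_power: "(\<lambda>s. s x ^ k * h s) \<in> M" if mem: "h \<in> M" for h k
    by (induction k) (use mem M_x in \<open>simp_all add: mult.assoc\<close>)
  have M_mult: "(\<lambda>s. h s * h' s) \<in> M" if mem: "h \<in> M" "h' \<in> M" for h h'
  proof -
    obtain c where c: "\<And>k. c k \<in> ?R" and h: "h = (\<lambda>s. \<Sum>k\<le>n. c k (E s) * s x ^ k)"
      using mem unfolding M_def by blast
    have "(\<lambda>s. \<Sum>k\<le>n. c k (E s) * (s x ^ k * h' s)) \<in> M"
      by (intro M_sum M_coeff c M_x_power mem)
    then show ?thesis
      by (simp add: h sum_distrib_right mult.assoc)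
  qed
  have "(\<lambda>s. H (E s)) \<in> M"
    using H
  proof induction
    case (const c)
    show ?case
      using M_coeff[OF int_poly_fun.const M_1] by simp
  next
    case (var v)
    show ?case
    proof (cases "v = Inr x")
      case True
      then show ?thesis
        using M_x[OF M_1] by (simp add: E_def)
    next
      case False
      then have "(\<lambda>t. t v) \<in> ?R"
        using var by (intro int_poly_fun.var) auto
      from M_coeff[OF this M_1] show ?thesis
        by simp
    qed
  qed (simp_all add: M_add M_mult)
  then obtain c where c: "\<And>k. c k \<in> ?R" "(\<lambda>s. H (E s)) = (\<lambda>s. \<Sum>k\<le>n. c k (E s) * s x ^ k)"
    unfolding M_def by blast
  show ?thesis
    using fun_cong[OF c(2)] by (intro that[of c] c(1)) simp
qed

text \<open>Recovers the elementary symmetric polynomials of \<open>I - {a}\<close> from those of \<open>I\<close>.\<close>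
primrec drop_elem :: "(nat \<Rightarrow> complex) \<Rightarrow> complex \<Rightarrow> nat \<Rightarrow> complex" where
  "drop_elem e a 0 = 1"
| "drop_elem e a (Suc k) = e (Suc k) - a * drop_elem e a k"

lemma drop_elem_elem_sym:
  assumes "finite I" "x \<notin> I"
  shows "drop_elem (\<lambda>k. elem_sym k (insert x I) s) (s x) k = elem_sym k I s"
  by (induction k) (simp_all add: assms elem_sym_insert)

text \<open>The fundamental theorem on symmetric polynomials with parameters \<open>P\<close>. In
  the induction the variable that is split off becomes a parameter; later, parameters allow the two
  groups of variables of \<open>Q\<^sub>n\<close> to be treated one after the other.\<close>

lemma symmetric_int_poly_fun:
  assumes "finite X" "F \<in> int_poly_fun (X \<union> P)" "X \<inter> P = {}"
    and "\<And>s x y. x \<in> X \<Longrightarrow> y \<in> X \<Longrightarrow> F (s \<circ> Transposition.transpose x y) = F s"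
  shows "\<exists>G \<in> int_poly_fun (Inl ` {1..card X} \<union> Inr ` P).
    \<forall>s. F s = G (case_sum (\<lambda>k. elem_sym k X s) s)"
  using assms
proof (induction X arbitrary: P rule: finite_induct)
  case empty
  then show ?case
    by (intro bexI[of _ "\<lambda>t. F (\<lambda>v. t (Inr v))"])
      (auto intro!: int_poly_fun_comp[of F P] int_poly_fun.var)
next
  case (insert x X)
  let ?n = "card X" and ?I = "insert x X"
  let ?E = "\<lambda>s. case_sum (\<lambda>k. elem_sym k ?I s) s"
  have I: "finite ?I" "x \<in> ?I" "card ?I = Suc ?n"
    using insert.hyps by auto
  have "\<exists>G \<in> int_poly_fun (Inl ` {1..?n} \<union> Inr ` insert x P).
      \<forall>s. F s = G (case_sum (\<lambda>k. elem_sym k X s) s)"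
    using insert.prems insert.hyps by (intro insert.IH) auto
  then obtain G where G: "G \<in> int_poly_fun (Inl ` {1..?n} \<union> Inr ` insert x P)"
    "\<And>s. F s = G (case_sum (\<lambda>k. elem_sym k X s) s)"
    by blast
  \<comment> \<open>Expresses the elementary symmetric polynomials of \<open>X\<close> by those of
    \<open>insert x X\<close> and \<open>s x\<close>, so that \<open>F\<close> becomes a polynomial
    in the latter.\<close>
  define \<sigma> where "\<sigma> = (\<lambda>t. case_sum (drop_elem (\<lambda>k. t (Inl k)) (t (Inr x))) (\<lambda>v. t (Inr v)))"
  have drop: "(\<lambda>t. drop_elem (\<lambda>k. t (Inl k)) (t (Inr x)) k)
      \<in> int_poly_fun (Inl ` {1..Suc ?n} \<union> Inr ` insert x P)" if "k \<le> Suc ?n" for k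
    using that
  proof (induction k)
    case (Suc k)
    then show ?case
      unfolding drop_elem.simps
      by (intro int_poly_fun_diff int_poly_fun.mult int_poly_fun.var) auto
  qed (simp add: int_poly_fun_1)
  have "(\<lambda>t. G (\<sigma> t)) \<in> int_poly_fun (Inl ` {1..Suc ?n} \<union> Inr ` insert x P)"
    by (rule int_poly_fun_comp[OF G(1)]) (use drop in \<open>auto simp: \<sigma>_def intro!: int_poly_fun.var\<close>)
  from int_poly_fun_reduce[OF I this] obtain c
    where c: "\<And>k. c k \<in> int_poly_fun (Inl ` {1..Suc ?n} \<union> Inr ` P)"
      "\<And>s. G (\<sigma> (?E s)) = (\<Sum>k\<le>?n. c k (?E s) * s x ^ k)"
    by blast
  have "\<sigma> (?E s) = case_sum (\<lambda>k. elem_sym k X s) s" for s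
    by (rule ext) (auto simp: \<sigma>_def drop_elem_elem_sym insert.hyps split: sum.split)
  then have F_eq: "F s = (\<Sum>k\<le>?n. c k (?E s) * s x ^ k)" for s
    using c(2)[of s] G(2)[of s] by simp
  \<comment> \<open>A transposition of \<open>x\<close> and \<open>y\<close> changes neither
    \<open>F\<close> nor the coefficients, which depend only on symmetric functions and on
    parameters outside \<open>insert x X\<close>. Only the power of \<open>s x\<close> is
    affected.\<close>
  have F_eq': "F s = (\<Sum>k\<le>?n. c k (?E s) * s y ^ k)" if y: "y \<in> ?I" for s y
  proof -
    let ?s = "s \<circ> Transposition.transpose x y"
    have c_eq: "c k (?E ?s) = c k (?E s)" for k
    proof (rule int_poly_fun_cong[OF c(1)])
      fix v assume "v \<in> Inl ` {1..Suc ?n} \<union> Inr ` P"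
      then show "?E ?s v = ?E s v"
      proof
        assume "v \<in> Inl ` {1..Suc ?n}"
        then show ?thesis
          using y by (auto intro!: elem_sym_permute)
      next
        assume "v \<in> Inr ` P"
        then show ?thesis
          using y insert.prems(2) by (auto simp: Transposition.transpose_def)
      qed
    qed
    have "F s = F ?s"
      using y by (intro insert.prems(3)[symmetric]) auto
    also have "\<dots> = (\<Sum>k\<le>?n. c k (?E ?s) * s y ^ k)"
      by (simp add: F_eq)
    finally show ?thesis
      by (simp only: c_eq)
  qed
  have "F s = c 0 (?E s)" if "inj_on s ?I" for s
  proof -
    \<comment> \<open>This polynomial has degree at most \<open>?n\<close>, yet vanishes at the
      \<open>Suc ?n\<close> values \<open>s y\<close>, which are distinct by injectivity. So it is
      zero, and its constant coefficient gives the claim.\<close>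
    define p where "p = (\<Sum>k\<le>?n. Polynomial.monom (c k (?E s)) k) - [:F s:]"
    have root: "poly p z = 0" if "z \<in> s ` ?I" for z
    proof -
      obtain y where "y \<in> ?I" "z = s y"
        using \<open>z \<in> s ` ?I\<close> by blast
      then show ?thesis
        using F_eq'[of y s] by (simp add: p_def poly_sum poly_monom del: insert_iff)
    qed
    have "Polynomial.degree p \<le> ?n"
      unfolding p_def by (intro degree_diff_le degree_sum_le) (auto intro: degree_monom_le order.trans)
    moreover have "card (s ` ?I) = Suc ?n"
      using card_image[OF \<open>inj_on s ?I\<close>] I(3) by simp
    ultimately have "p = 0"
      using root by (intro poly_eqI_degree[of "s ` ?I" p 0]) (simp_all del: image_insert)
    then have "poly.coeff p 0 = 0"
      by simp
    then show ?thesis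
      by (simp add: p_def coeff_sum sum.delta)
  qed
  moreover have "(\<lambda>s. c 0 (?E s)) \<in> int_poly_fun (?I \<union> P)"
    by (rule int_poly_fun_comp[OF c(1)])
      (auto simp: elem_sym_def intro!: int_poly_fun_sum int_poly_fun_prod int_poly_fun.var)
  \<comment> \<open>Density removes the injectivity of \<open>s\<close>.\<close>
  ultimately have "F s = c 0 (?E s)" for s
    using int_poly_fun_eqI_inj[OF insert.prems(1) _ I(1)] by blast
  then show ?case
    using c(1)[of 0] I(3) by auto
qed

subsection \<open>The polynomials defining the product\<close>

lemma case_sum_elem_sym_surj:
  fixes s :: "nat + nat \<Rightarrow> complex"
  obtains x y where "\<And>v. v \<in> Inl ` {1..n} \<union> Inr ` {1..n} \<Longrightarrow>
    case_sum (\<lambda>k. elem_sym k {1..n} x) (\<lambda>k. elem_sym k {1..n} y) v = s v"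
proof -
  obtain x where "\<And>k. k \<in> {1..n} \<Longrightarrow> elem_sym k {1..n} x = s (Inl k)"
    using elem_sym_surj[of n "\<lambda>k. s (Inl k)"] by blast
  moreover obtain y where "\<And>k. k \<in> {1..n} \<Longrightarrow> elem_sym k {1..n} y = s (Inr k)"
    using elem_sym_surj[of n "\<lambda>k. s (Inr k)"] by blast
  ultimately show ?thesis
    by (intro that[of x y]) auto
qed

text \<open>\<open>symmetric_int_poly_fun\<close> is applied twice: first to the \<open>x i\<close>
  with the \<open>y j\<close> as parameters, then to the \<open>y j\<close> with the elementary
  symmetric functions of the \<open>x i\<close> as parameters.\<close>

lemma elem_sym_products_int_poly:
  obtains q :: "(nat + nat) int_mpoly"
  where "mvars q \<subseteq> Inl ` {1..n} \<union> Inr ` {1..n}"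
    "\<And>x y :: nat \<Rightarrow> complex. elem_sym n ({1..n} \<times> {1..n}) (\<lambda>(i, j). x i * y j) =
      minsert (case_sum (\<lambda>k. elem_sym k {1..n} x) (\<lambda>k. elem_sym k {1..n} y)) q"
proof -
  let ?N = "{1..n}" and ?e = "\<lambda>x k. elem_sym k {1..n} x"
  let ?X = "Inl ` ?N :: (nat + nat) set" and ?Y = "Inr ` ?N :: (nat + nat) set"
  let ?Y' = "Inr ` ?Y :: (nat + (nat + nat)) set"
  define F :: "(nat + nat \<Rightarrow> complex) \<Rightarrow> complex"
    where "F = (\<lambda>s. elem_sym n (?N \<times> ?N) (\<lambda>p. s (Inl (fst p)) * s (Inr (snd p))))"
  have F_perm: "F s = F t"
    if h: "bij_betw h ?N ?N" "bij_betw h' ?N ?N"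
      and st: "\<And>i. i \<in> ?N \<Longrightarrow> s (Inl i) = t (Inl (h i))" "\<And>i. i \<in> ?N \<Longrightarrow> s (Inr i) = t (Inr (h' i))"
    for s t h h'
  proof -
    have "F s = elem_sym n (?N \<times> ?N) ((\<lambda>p. t (Inl (fst p)) * t (Inr (snd p))) \<circ> map_prod h h')"
      unfolding F_def by (rule elem_sym_cong) (auto simp: st)
    also have "\<dots> = F t"
      unfolding F_def by (rule elem_sym_permute) (rule bij_betw_map_prod[OF h])
    finally show ?thesis .
  qed
  have "F \<in> int_poly_fun (?X \<union> ?Y)"
    unfolding F_def elem_sym_def
    by (intro int_poly_fun_sum int_poly_fun_prod int_poly_fun.mult int_poly_fun.var) auto
  moreover have "F (s \<circ> Transposition.transpose u v) = F s" if "u \<in> ?X" "v \<in> ?X" for s u v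
  proof -
    obtain a b where "u = Inl a" "v = Inl b" "a \<in> ?N" "b \<in> ?N"
      using \<open>u \<in> ?X\<close> \<open>v \<in> ?X\<close> by blast
    then show ?thesis
      by (intro F_perm[of "Transposition.transpose a b" id]) (auto simp: Transposition.transpose_def)
  qed
  ultimately obtain G where G: "G \<in> int_poly_fun (Inl ` {1..card ?X} \<union> Inr ` ?Y)"
      "\<And>s. F s = G (case_sum (\<lambda>k. elem_sym k ?X s) s)"
    using symmetric_int_poly_fun[of ?X F ?Y] by blast
  have card: "card (Inl ` A) = card A" "card (Inr ` B) = card B" for A :: "'l set" and B :: "'r set"
    by (simp_all add: card_image)
  have elem: "elem_sym k (Inl ` A) s = elem_sym k A (\<lambda>i. s (Inl i))"
    for k and A :: "'l set" and s :: "'l + 'r \<Rightarrow> complex"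
    by (subst elem_sym_reindex) (simp_all add: o_def)
  have elem': "elem_sym k (Inr ` B) s = elem_sym k B (\<lambda>i. s (Inr i))"
    for k and B :: "'r set" and s :: "'l + 'r \<Rightarrow> complex"
    by (subst elem_sym_reindex) (simp_all add: o_def)
  \<comment> \<open>\<open>G\<close> is tied to \<open>F\<close> only where its first arguments are
    elementary symmetric functions of some \<open>x\<close>. By \<open>elem_sym_surj\<close> every
    point is of this form, so the symmetry of \<open>F\<close> in the second group passes to
    \<open>G\<close> everywhere.\<close>
  have G_eq: "G t = F (case_sum x (\<lambda>j. t (Inr (Inr j))))"
    if "\<And>k. k \<in> ?N \<Longrightarrow> ?e x k = t (Inl k)" for t x
    unfolding G(2) using that by (intro int_poly_fun_cong[OF G(1)]) (auto simp: card elem)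
  have "G (t \<circ> Transposition.transpose u v) = G t" if "u \<in> ?Y'" "v \<in> ?Y'" for t u v
  proof -
    obtain a b where uv: "u = Inr (Inr a)" "v = Inr (Inr b)" and ab: "a \<in> ?N" "b \<in> ?N"
      using \<open>u \<in> ?Y'\<close> \<open>v \<in> ?Y'\<close> by blast
    obtain x where x: "\<And>k. k \<in> ?N \<Longrightarrow> ?e x k = t (Inl k)"
      using elem_sym_surj[of n "\<lambda>k. t (Inl k)"] by blast
    have "F (case_sum x (\<lambda>j. (t \<circ> Transposition.transpose u v) (Inr (Inr j)))) =
        F (case_sum x (\<lambda>j. t (Inr (Inr j))))"
      by (rule F_perm[of id "Transposition.transpose a b"])
        (use ab in \<open>auto simp: uv Transposition.transpose_def\<close>)
    moreover have "\<And>k. k \<in> ?N \<Longrightarrow> ?e x k = (t \<circ> Transposition.transpose u v) (Inl k)"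
      using x by (simp add: uv Transposition.transpose_def)
    ultimately show ?thesis
      using G_eq[of x t] G_eq[of x "t \<circ> Transposition.transpose u v"] x by simp
  qed
  moreover have "G \<in> int_poly_fun (?Y' \<union> Inl ` ?N)"
    using G(1) by (simp add: card Un_commute)
  ultimately obtain H where H: "H \<in> int_poly_fun (Inl ` {1..card ?Y'} \<union> Inr ` Inl ` ?N)"
      "\<And>t. G t = H (case_sum (\<lambda>k. elem_sym k ?Y' t) t)"
    using symmetric_int_poly_fun[of ?Y' G "Inl ` ?N"] by blast
  \<comment> \<open>In \<open>H\<close> the outer \<open>Inl k\<close> stands for the symmetric
    functions of \<open>y\<close> and \<open>Inr (Inl k)\<close> for those of \<open>x\<close>; the
    remaining variables do not occur and are set to 0.\<close>
  define \<rho> :: "(nat + nat \<Rightarrow> complex) \<Rightarrow> nat + (nat + (nat + nat)) \<Rightarrow> complex"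
    where "\<rho> = (\<lambda>s. case_sum (\<lambda>k. s (Inr k)) (case_sum (\<lambda>k. s (Inl k)) (\<lambda>_. 0)))"
  have "(\<lambda>s. H (\<rho> s)) \<in> int_poly_fun (?X \<union> ?Y)"
    by (rule int_poly_fun_comp[OF H(1)]) (auto simp: \<rho>_def card intro!: int_poly_fun.var)
  then obtain q where q: "mvars q \<subseteq> ?X \<union> ?Y" "(\<lambda>s. H (\<rho> s)) = (\<lambda>s. minsert s q)"
    by (rule int_poly_fun_imp_minsert)
  have "elem_sym n (?N \<times> ?N) (\<lambda>(i, j). x i * y j) = minsert (case_sum (?e x) (?e y)) q"
    for x y :: "nat \<Rightarrow> complex"
  proof -
    let ?s = "case_sum x y" and ?t = "case_sum (?e x) (case_sum x y)"
    have "elem_sym n (?N \<times> ?N) (\<lambda>(i, j). x i * y j) = F ?s"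
      by (simp add: F_def case_prod_unfold)
    also have "\<dots> = G ?t"
      by (simp add: G(2) elem)
    also have "\<dots> = H (\<rho> (case_sum (?e x) (?e y)))"
      unfolding H(2) by (rule int_poly_fun_cong[OF H(1)]) (auto simp: \<rho>_def card elem')
    also have "\<dots> = minsert (case_sum (?e x) (?e y)) q"
      by (rule fun_cong[OF q(2)])
    finally show ?thesis .
  qed
  with q(1) show ?thesis
    by (rule that)
qed

text \<open>Both sides of the formal identity are integer polynomials, so by
  \<open>int_mpoly_eqI\<close> they may be compared at complex points.\<close>

lemma is_ene_poly_iff_complex:
  "is_ene_poly n q \<longleftrightarrow> mvars q \<subseteq> Inl ` {1..n} \<union> Inr ` {1..n} \<and>
    (\<forall>x y :: nat \<Rightarrow> complex. elem_sym n ({1..n} \<times> {1..n}) (\<lambda>(i, j). x i * y j) =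
      minsert (case_sum (\<lambda>k. elem_sym k {1..n} x) (\<lambda>k. elem_sym k {1..n} y)) q)"
  (is "_ \<longleftrightarrow> ?V \<and> (\<forall>x y. ?P x y)")
proof -
  let ?l = "elem_sym n ({1..n} \<times> {1..n}) (\<lambda>(i, j). mvar (Inl i) * mvar (Inr j)) :: (nat + nat) int_mpoly"
  let ?r = "minsert (case_sum (\<lambda>k. elem_sym k {1..n} (\<lambda>i. mvar (Inl i)))
    (\<lambda>k. elem_sym k {1..n} (\<lambda>j. mvar (Inr j)))) q :: (nat + nat) int_mpoly"
  have l: "minsert (case_sum x y) ?l = elem_sym n ({1..n} \<times> {1..n}) (\<lambda>(i, j). x i * y j)"
    for x y :: "nat \<Rightarrow> complex"
    by (simp add: minsert_elem_sym case_prod_unfold minsert_mult)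
  have r: "minsert (case_sum x y) ?r =
      minsert (case_sum (\<lambda>k. elem_sym k {1..n} x) (\<lambda>k. elem_sym k {1..n} y)) q"
    for x y :: "nat \<Rightarrow> complex"
    unfolding minsert_minsert
    by (rule minsert_cong) (simp add: minsert_elem_sym split: sum.split)
  have "?l = ?r \<longleftrightarrow> (\<forall>x y. ?P x y)"
  proof
    assume "?l = ?r"
    then show "\<forall>x y. ?P x y"
      using l r by metis
  next
    assume P: "\<forall>x y. ?P x y"
    show "?l = ?r"
    proof (rule int_mpoly_eqI)
      fix s :: "nat + nat \<Rightarrow> complex"
      have "s = case_sum (\<lambda>k. s (Inl k)) (\<lambda>k. s (Inr k))"
        by (simp add: surjective_sum)
      then show "minsert s ?l = minsert s ?r"
        using l r P by metis
    qed
  qed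
  then show ?thesis
    by (simp add: is_ene_poly_def)
qed

lemma is_ene_poly_ene_poly: "is_ene_poly n (ene_poly n)"
proof -
  obtain q where "is_ene_poly n q"
    using elem_sym_products_int_poly[of n] unfolding is_ene_poly_iff_complex by metis
  moreover have "q = q'" if q: "is_ene_poly n q" "is_ene_poly n q'" for q q'
  proof (rule int_mpoly_eqI)
    fix s :: "nat + nat \<Rightarrow> complex"
    obtain x y where xy: "\<And>v. v \<in> Inl ` {1..n} \<union> Inr ` {1..n} \<Longrightarrow>
        case_sum (\<lambda>k. elem_sym k {1..n} x) (\<lambda>k. elem_sym k {1..n} y) v = s v"
      using case_sum_elem_sym_surj[where n = n and s = s] by blast
    have "minsert s r = elem_sym n ({1..n} \<times> {1..n}) (\<lambda>(i, j). x i * y j)"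
      if "is_ene_poly n r" for r
    proof -
      have "minsert s r = minsert (case_sum (\<lambda>k. elem_sym k {1..n} x) (\<lambda>k. elem_sym k {1..n} y)) r"
        using that xy by (intro minsert_cong) (auto simp: is_ene_poly_def subset_iff)
      then show ?thesis
        using that by (simp add: is_ene_poly_iff_complex)
    qed
    then show "minsert s q = minsert s q'"
      using q by simp
  qed
  ultimately show ?thesis
    unfolding ene_poly_def by (metis theI)
qed

lemma minsert_ene_poly:
  fixes x y :: "nat \<Rightarrow> complex"
  assumes "\<And>k. k \<in> {1..n} \<Longrightarrow> a k = elem_sym k {1..n} x"
    and "\<And>k. k \<in> {1..n} \<Longrightarrow> b k = elem_sym k {1..n} y"
  shows "minsert (case_sum a b) (ene_poly n) =
    elem_sym n ({1..n} \<times> {1..n}) (\<lambda>(i, j). x i * y j)"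
proof -
  have "minsert (case_sum a b) (ene_poly n) =
      minsert (case_sum (\<lambda>k. elem_sym k {1..n} x) (\<lambda>k. elem_sym k {1..n} y)) (ene_poly n)"
    using is_ene_poly_ene_poly[of n] assms
    by (intro minsert_cong) (auto simp: is_ene_poly_def subset_iff)
  then show ?thesis
    using is_ene_poly_ene_poly[of n] by (simp add: is_ene_poly_iff_complex)
qed

subsection \<open>Logarithmic derivatives\<close>

text \<open>Newton's identities: since \<open>f\<close> has constant term 1, comparing coefficients
  at \<open>k\<close> expresses \<open>fps_nth u k\<close> by earlier coefficients of
  \<open>u\<close> and by those of \<open>f\<close> up to \<open>k\<close>.\<close>

lemma fps_log_deriv_coeffs_eq:
  fixes f g u v :: "'a::field fps"
  assumes "u * f = - (fps_X * fps_deriv f)" "v * g = - (fps_X * fps_deriv g)"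
    and "fps_nth f 0 = 1" "fps_nth g 0 = 1"
    and eq: "\<And>j. j \<le> n \<Longrightarrow> fps_nth f j = fps_nth g j"
    and "k \<le> n"
  shows "fps_nth u k = fps_nth v k"
  using \<open>k \<le> n\<close>
proof (induction k rule: less_induct)
  case (less k)
  have rec: "fps_nth w k = - of_nat k * fps_nth h k - (\<Sum>i<k. fps_nth w i * fps_nth h (k - i))"
    if "w * h = - (fps_X * fps_deriv h)" "fps_nth h 0 = 1" for w h :: "'a fps"
  proof -
    have "fps_nth (w * h) k = - of_nat k * fps_nth h k"
      unfolding that(1) by (cases k) (simp_all del: of_nat_Suc)
    moreover have "fps_nth (w * h) k = (\<Sum>i<k. fps_nth w i * fps_nth h (k - i)) + fps_nth w k"
      using that(2) by (simp add: fps_mult_nth atLeast0AtMost flip: lessThan_Suc_atMost)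
    ultimately show ?thesis
      by (simp add: eq_diff_eq add.commute)
  qed
  have "(\<Sum>i<k. fps_nth u i * fps_nth f (k - i)) = (\<Sum>i<k. fps_nth v i * fps_nth g (k - i))"
    using less by (intro sum.cong) (auto simp: eq)
  then show ?case
    unfolding rec[OF assms(1,3)] rec[OF assms(2,4)] using less.prems by (simp add: eq)
qed

text \<open>The same recurrence solved for \<open>f\<close>. Since \<open>u\<close> has no constant
  term, the coefficient of \<open>f\<close> at \<open>k\<close> occurs only with the factor
  \<open>- of_nat k\<close>, which is invertible in characteristic 0 for positive
  \<open>k\<close>.\<close>

lemma fps_coeffs_eq_of_log_deriv:
  fixes f g u v :: "'a::field_char_0 fps"
  assumes "u * f = - (fps_X * fps_deriv f)" "v * g = - (fps_X * fps_deriv g)"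
    and "fps_nth f 0 = 1" "fps_nth g 0 = 1"
    and eq: "\<And>j. j \<le> n \<Longrightarrow> fps_nth u j = fps_nth v j"
    and "k \<le> n"
  shows "fps_nth f k = fps_nth g k"
  using \<open>k \<le> n\<close>
proof (induction k rule: less_induct)
  case (less k)
  show ?case
  proof (cases "k = 0")
    case False
    have rec: "- of_nat k * fps_nth h k = (\<Sum>i\<in>{1..k}. fps_nth w i * fps_nth h (k - i))"
      if "w * h = - (fps_X * fps_deriv h)" "fps_nth h 0 = 1" for w h :: "'a fps"
    proof -
      have "fps_nth w 0 = 0"
        using arg_cong[OF that(1), of "\<lambda>p. fps_nth p 0"] that(2) by simp
      moreover have "fps_nth (w * h) k = - of_nat k * fps_nth h k"
        unfolding that(1) by (cases k) (simp_all del: of_nat_Suc)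
      ultimately show ?thesis
        by (simp add: fps_mult_nth sum.atLeast_Suc_atMost)
    qed
    have "(\<Sum>i\<in>{1..k}. fps_nth u i * fps_nth f (k - i)) = (\<Sum>i\<in>{1..k}. fps_nth v i * fps_nth g (k - i))"
      using less by (intro sum.cong) (auto simp: eq)
    then have "- of_nat k * fps_nth f k = - of_nat k * fps_nth g k"
      unfolding rec[OF assms(1,3)] rec[OF assms(2,4)] .
    then show ?thesis
      using False by simp
  qed (simp add: assms)
qed

text \<open>A factor 1 - c z contributes c z / (1 - c z), and logarithmic derivatives of products
  add. These series have no constant term, hence the value 0 in place of \<open>card I\<close> at
  \<open>k = 0\<close>.\<close>

lemma fps_log_deriv_prod_linear:
  fixes c :: "'i \<Rightarrow> 'a::field"
  assumes "finite I"
  shows "Abs_fps (\<lambda>k. if k = 0 then 0 else \<Sum>i\<in>I. c i ^ k) * (\<Prod>i\<in>I. 1 - fps_const (c i) * fps_X) =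
    - (fps_X * fps_deriv (\<Prod>i\<in>I. 1 - fps_const (c i) * fps_X))"
  using assms
proof induction
  case empty
  then show ?case
    by (simp add: fps_eq_iff fps_mult_nth)
next
  case (insert x I)
  let ?u = "\<lambda>I. Abs_fps (\<lambda>k. if k = 0 then 0 else \<Sum>i\<in>I. c i ^ k)"
  let ?v = "Abs_fps (\<lambda>k. if k = 0 then 0 else c x ^ k)"
  let ?l = "1 - fps_const (c x) * fps_X" and ?P = "\<Prod>i\<in>I. 1 - fps_const (c i) * fps_X"
  have "fps_nth (?v * ?l) k = fps_nth (- (fps_X * fps_deriv ?l)) k" for k
  proof -
    have "?v * ?l = ?v - fps_const (c x) * (?v * fps_X)"
      by (simp add: algebra_simps)
    then show ?thesis
      by (cases k rule: nat.exhaust[case_names 0 Suc]) (auto simp: power_eq_if)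
  qed
  then have l: "?v * ?l = - (fps_X * fps_deriv ?l)"
    by (simp add: fps_eq_iff)
  have "?u (insert x I) = ?v + ?u I"
    using insert.hyps by (simp add: fps_eq_iff)
  then have "?u (insert x I) * (?l * ?P) = (?v * ?l) * ?P + ?l * (?u I * ?P)"
    by (simp add: algebra_simps)
  also have "\<dots> = - (fps_X * fps_deriv (?l * ?P))"
  proof -
    have "- (a * b) * c + d * - (a * e) = - (a * (d * e + b * c))" for a b c d e :: "'a fps"
      by (simp add: algebra_simps)
    then show ?thesis
      unfolding l insert.IH fps_deriv_mult .
  qed
  finally show ?case
    using insert.hyps by simp
qed

lemma sum_fps_const: "(\<Sum>i\<in>I. fps_const (f i)) = fps_const (\<Sum>i\<in>I. f i)"
  by (induction I rule: infinite_finite_induct) simp_all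

lemma prod_fps_const: "(\<Prod>i\<in>I. fps_const (f i :: 'a::comm_ring_1)) = fps_const (\<Prod>i\<in>I. f i)"
  by (induction I rule: infinite_finite_induct) simp_all

lemma fps_nth_prod_linear:
  fixes c :: "'i \<Rightarrow> 'a::comm_ring_1"
  assumes "finite I" "k \<le> card I"
  shows "fps_nth (\<Prod>i\<in>I. 1 - fps_const (c i) * fps_X) k = elem_sym k I (\<lambda>i. - c i)"
proof -
  have "(\<Prod>i\<in>I. 1 - fps_const (c i) * fps_X) = (\<Prod>i\<in>I. 1 + fps_X * fps_const (- c i))"
    by (simp add: mult.commute flip: fps_const_neg)
  also have "\<dots> = (\<Sum>j\<le>card I. elem_sym j I (\<lambda>i. fps_const (- c i)) * fps_X ^ j)"
    using prod_add_mult_elem_sym[OF assms(1), of 1 fps_X "\<lambda>i. fps_const (- c i)"] by simp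
  also have "\<dots> = (\<Sum>j\<le>card I. fps_const (elem_sym j I (\<lambda>i. - c i)) * fps_X ^ j)"
    by (simp only: elem_sym_def sum_fps_const prod_fps_const)
  finally show ?thesis
    using assms(2) by (simp add: fps_sum_nth fps_X_power_nth if_distrib[of "\<lambda>z. _ * z"] cong: if_cong)
qed

lemma elem_sym_uminus: "elem_sym k I (\<lambda>i. - x i) = (- 1) ^ k * elem_sym k I x"
  by (simp add: elem_sym_def prod_uminus sum_distrib_left)

definition neg_log_deriv :: "'a::field fps \<Rightarrow> 'a fps" where
  "neg_log_deriv f = - (fps_X * fps_deriv f) * inverse f"

lemma neg_log_deriv_mult:
  assumes "fps_nth f 0 \<noteq> 0"
  shows "neg_log_deriv f * f = - (fps_X * fps_deriv f)"
  using inverse_mult_eq_1[OF assms] by (simp add: neg_log_deriv_def mult.assoc)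

text \<open>
  The first \<open>n\<close> coefficients of \<open>f\<close> and \<open>g\<close> are those of polynomials \<open>\<Prod> (1 - c\<^sub>i z)\<close> and
  \<open>\<Prod> (1 - d\<^sub>j z)\<close>, whose product is \<open>\<Prod> (1 - c\<^sub>i d\<^sub>j z)\<close>; the coefficients of the negated
  logarithmic derivatives are the power sums of the reciprocal roots, which multiply.
\<close>
lemma ene_prod_eqI:
  assumes "fps_nth f 0 = 1" "fps_nth g 0 = 1" "fps_nth h 0 = 1"
    and h: "Abs_fps (\<lambda>k. fps_nth (neg_log_deriv f) k * fps_nth (neg_log_deriv g) k) * h =
      - (fps_X * fps_deriv h)"
  shows "f \<star> g = h"
proof (rule fps_ext)
  fix n
  show "fps_nth (f \<star> g) n = fps_nth h n"
  proof (cases "n = 0")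
    case True
    then show ?thesis
      using assms by (simp add: ene_prod_def)
  next
    case False
    let ?N = "{1..n}" and ?L = "\<lambda>I c. \<Prod>i\<in>I. 1 - fps_const (c i) * fps_X :: complex fps"
    let ?p = "\<lambda>I c. Abs_fps (\<lambda>k. if k = 0 then 0 else \<Sum>i\<in>I. c i ^ k) :: complex fps"
    \<comment> \<open>Up to degree \<open>n\<close> the series is the product of the factors 1 + x i
      z, so the reciprocal roots are the \<open>- x i\<close>. The signs cancel in the products
      \<open>x i * y j\<close>.\<close>
    have ex: "\<exists>x. (\<forall>k\<in>?N. fps_nth F k = elem_sym k ?N x) \<and>
        (\<forall>k\<le>n. fps_nth (neg_log_deriv F) k = fps_nth (?p ?N (\<lambda>i. - x i)) k)"
      if F: "fps_nth F 0 = 1" for F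
    proof -
      obtain x where x: "\<And>k. k \<in> ?N \<Longrightarrow> elem_sym k ?N x = fps_nth F k"
        using elem_sym_surj[of n "fps_nth F"] by blast
      have coeff: "fps_nth F k = fps_nth (?L ?N (\<lambda>i. - x i)) k" if "k \<le> n" for k
        using that x[of k] F by (cases "k = 0") (simp_all add: fps_nth_prod_linear)
      have "fps_nth (neg_log_deriv F) k = fps_nth (?p ?N (\<lambda>i. - x i)) k" if "k \<le> n" for k
        using F coeff[of 0] that
        by (intro fps_log_deriv_coeffs_eq[OF neg_log_deriv_mult fps_log_deriv_prod_linear _ _ coeff]) auto
      with x show ?thesis
        by (intro exI[of _ x]) simp
    qed
    obtain x where x: "\<And>k. k \<in> ?N \<Longrightarrow> fps_nth f k = elem_sym k ?N x"
        "\<And>k. k \<le> n \<Longrightarrow> fps_nth (neg_log_deriv f) k = fps_nth (?p ?N (\<lambda>i. - x i)) k"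
      using ex[OF assms(1)] by blast
    obtain y where y: "\<And>k. k \<in> ?N \<Longrightarrow> fps_nth g k = elem_sym k ?N y"
        "\<And>k. k \<le> n \<Longrightarrow> fps_nth (neg_log_deriv g) k = fps_nth (?p ?N (\<lambda>i. - y i)) k"
      using ex[OF assms(2)] by blast
    let ?xy = "\<lambda>(i, j). x i * y j"
    \<comment> \<open>There are n^2 factors, so the coefficient at \<open>n\<close> is within the
      range of \<open>fps_nth_prod_linear\<close>.\<close>
    have card: "n \<le> card (?N \<times> ?N)"
      by (simp add: card_cartesian_product)
    have "fps_nth (f \<star> g) n = (- 1) ^ n * elem_sym n (?N \<times> ?N) ?xy"
      using False minsert_ene_poly[OF x(1) y(1)] by (simp add: ene_prod_def)
    also have "\<dots> = fps_nth (?L (?N \<times> ?N) ?xy) n"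
      by (subst fps_nth_prod_linear[OF _ card]) (simp_all add: elem_sym_uminus)
    also have "\<dots> = fps_nth h n"
    proof (rule fps_coeffs_eq_of_log_deriv[OF fps_log_deriv_prod_linear h _ assms(3)])
      show "fps_nth (?L (?N \<times> ?N) ?xy) 0 = 1"
        by (subst fps_nth_prod_linear) simp_all
      fix k assume "k \<le> n"
      moreover have "(\<Sum>p\<in>?N \<times> ?N. ?xy p ^ k) = (\<Sum>i\<in>?N. (- x i) ^ k) * (\<Sum>j\<in>?N. (- y j) ^ k)"
        by (simp add: sum_product sum.cartesian_product case_prod_unfold flip: power_mult_distrib)
      ultimately show "fps_nth (?p (?N \<times> ?N) ?xy) k =
          fps_nth (Abs_fps (\<lambda>k. fps_nth (neg_log_deriv f) k * fps_nth (neg_log_deriv g) k)) k"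
        using x(2) y(2) by simp
    qed simp_all
    finally show ?thesis .
  qed
qed

subsection \<open>Radii of convergence\<close>

text \<open>For finite \<open>B = b\<close>, any \<open>s\<close> strictly between
  \<open>r / b\<close> and \<open>A\<close> works with \<open>t = r / s\<close>; for infinite
  \<open>B\<close>, any positive \<open>s\<close> below \<open>A\<close> does.\<close>

lemma ereal_less_mult_imp_factors:
  fixes A B :: ereal
  assumes "0 < r" "ereal r < A * B" "0 \<le> A" "0 \<le> B"
  obtains s t where "0 < s" "0 < t" "ereal s < A" "ereal t < B" "r = s * t"
proof -
  have "0 < A * B"
    using assms(1,2) by (metis ereal_less(2) less_trans)
  then have AB: "0 < A" "0 < B"
    using assms(3,4) by (auto simp: order_less_le)
  have "\<exists>s>0. ereal s < A \<and> ereal (r / s) < B"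
  proof (cases B)
    case (real b)
    then have b: "0 < b" using AB by simp
    have "ereal (r / b) < A"
      using assms(2) b real by (cases A) (auto simp: field_simps)
    then obtain s where s: "r / b < s" "ereal s < A"
      using ereal_dense2 by (metis less_ereal.simps(1))
    moreover have "0 < r / b" using assms(1) b by simp
    ultimately have "0 < s" by linarith
    moreover have "r / s < b"
      using s b \<open>0 < s\<close> by (simp add: field_simps)
    ultimately show ?thesis
      using s real by auto
  next
    case PInf
    obtain s where "0 < s" "ereal s < A"
      using AB(1) ereal_dense2[of 0 A] by auto
    then show ?thesis
      using PInf by auto
  qed (use AB in simp)
  then obtain s where "s > 0" "ereal s < A" "ereal (r / s) < B"
    by blast
  then show ?thesis
    using assms(1) by (intro that[of s "r / s"]) auto
qed

text \<open>Writing \<open>r = s * t\<close> splits the terms into those of an absolutely convergent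
  series and factors that tend to 0.\<close>

lemma conv_radius_hadamard_ge:
  fixes a b :: "nat \<Rightarrow> complex"
  shows "conv_radius (\<lambda>n. a n * b n) \<ge> conv_radius a * conv_radius b"
proof (rule conv_radius_geI_ex')
  fix r assume r: "0 < r" "ereal r < conv_radius a * conv_radius b"
  then obtain s t where st: "0 < s" "0 < t" "ereal s < conv_radius a" "ereal t < conv_radius b" "r = s * t"
    using ereal_less_mult_imp_factors conv_radius_nonneg by metis
  have a: "summable (\<lambda>n. norm (a n * of_real s ^ n))"
    using st by (intro abs_summable_in_conv_radius) simp
  have "summable (\<lambda>n. b n * of_real t ^ n)"
    using st by (intro summable_in_conv_radius) simp
  then have "(\<lambda>n. norm (b n * of_real t ^ n)) \<longlonglongrightarrow> 0"
    by (intro tendsto_norm_zero summable_LIMSEQ_zero)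
  then have "eventually (\<lambda>n. norm (b n * of_real t ^ n) < 1) sequentially"
    by (rule order_tendstoD) simp
  then have "eventually (\<lambda>n. norm (a n * b n * of_real r ^ n) \<le> norm (a n * of_real s ^ n)) sequentially"
  proof eventually_elim
    case (elim n)
    have "norm (a n * b n * of_real r ^ n) = norm (a n * of_real s ^ n) * norm (b n * of_real t ^ n)"
      unfolding norm_mult[symmetric] by (simp add: st power_mult_distrib mult_ac)
    then show ?case
      using elim by (simp add: mult_left_le)
  qed
  then show "summable (\<lambda>n. a n * b n * of_real r ^ n)"
    using a by (rule summable_comparison_test_ev)
qed

text \<open>The solution is h = exp v, where v is minus the integral of u / z. It is holomorphic on
  the disk of convergence of \<open>u\<close>, so its Taylor series converges there.\<close>

lemma fps_exp_integral:
  fixes u :: "complex fps"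
  assumes "fps_nth u 0 = 0" "0 < fps_conv_radius u"
  obtains h where "fps_nth h 0 = 1" "u * h = - (fps_X * fps_deriv h)"
    "fps_conv_radius u \<le> fps_conv_radius h"
proof -
  let ?R = "fps_conv_radius u"
  define v where "v = Abs_fps (\<lambda>k. - fps_nth u k / of_nat k)"
  have v0: "fps_nth v 0 = 0"
    by (simp add: v_def)
  have u_eq: "u = - (fps_X * fps_deriv v)"
  proof (rule fps_ext)
    fix k show "fps_nth u k = fps_nth (- (fps_X * fps_deriv v)) k"
      by (cases k) (simp_all add: v_def assms(1) del: of_nat_Suc)
  qed
  have "?R \<le> fps_conv_radius v"
    unfolding fps_conv_radius_def
  proof (rule conv_radius_geI_ex')
    fix r assume r: "0 < r" "ereal r < conv_radius (fps_nth u)"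
    show "summable (\<lambda>n. fps_nth v n * of_real r ^ n)"
    proof (rule summable_comparison_test')
      show "summable (\<lambda>n. norm (fps_nth u n * of_real r ^ n))"
        using r by (intro abs_summable_in_conv_radius) simp
      fix n
      \<comment> \<open>Integration divides by \<open>n\<close>, which only shrinks coefficients; at
        \<open>n = 0\<close> division by zero yields 0.\<close>
      have "norm (fps_nth v n) \<le> norm (fps_nth u n)"
        using mult_left_mono[of 1 "real n" "norm (fps_nth u n)"]
        by (cases "n = 0") (simp_all add: v_def norm_divide divide_le_eq)
      then show "norm (fps_nth v n * of_real r ^ n) \<le> norm (fps_nth u n * of_real r ^ n)"
        by (simp add: norm_mult mult_right_mono)
    qed
  qed
  then have v: "eval_fps v holomorphic_on eball 0 ?R" "0 < fps_conv_radius v"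
    using assms(2) by (auto intro!: holomorphic_intros eball_mono)
  define E where "E = (\<lambda>z. exp (eval_fps v z))"
  define h where "h = fps_expansion E 0"
  have E: "E holomorphic_on eball 0 ?R"
    unfolding E_def by (intro holomorphic_intros v)
  have h: "E has_fps_expansion h"
    unfolding h_def using E assms(2)
    by (intro has_fps_expansion_fps_expansion[of "eball 0 ?R"]) (auto simp: zero_ereal_def)
  have "deriv E has_fps_expansion fps_deriv h"
    by (intro has_fps_expansion_deriv h)
  \<comment> \<open>The chain rule gives a second expansion of the derivative of \<open>E\<close>;
    uniqueness of expansions yields the differential equation for formal series.\<close>
  moreover have "deriv E has_fps_expansion h * fps_deriv v"
  proof -
    have exp: "(\<lambda>z. E z * eval_fps (fps_deriv v) z) has_fps_expansion h * fps_deriv v"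
      using v(2) fps_conv_radius_deriv[of v]
      by (intro has_fps_expansion_mult h eval_fps_has_fps_expansion) order
    have "eventually (\<lambda>z. z \<in> eball 0 (fps_conv_radius v)) (nhds 0)"
      using v(2) by (intro eventually_nhds_in_open) (auto simp: zero_ereal_def)
    then have ev: "eventually (\<lambda>z. E z * eval_fps (fps_deriv v) z = deriv E z) (nhds 0)"
    proof eventually_elim
      case (elim z)
      then show ?case
        unfolding E_def
        by (intro DERIV_imp_deriv[symmetric] DERIV_fun_exp has_field_derivative_eval_fps) simp
    qed
    show ?thesis
      using exp unfolding has_fps_expansion_cong[OF ev refl] .
  qed
  ultimately have "fps_deriv h = h * fps_deriv v"
    by (rule fps_expansion_unique_complex)
  then have "u * h = - (fps_X * fps_deriv h)"
    by (simp add: u_eq mult_ac)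
  moreover have "fps_nth h 0 = 1"
    using fps_nth_fps_expansion[OF h, of 0] by (simp add: E_def eval_fps_at_0 v0)
  moreover have "?R \<le> fps_conv_radius h"
    unfolding h_def by (rule conv_radius_fps_expansion[OF E])
  ultimately show ?thesis
    by (intro that)
qed

lemma ene_radius_nonneg: "0 \<le> ene_radius f"
  by (auto simp: ene_radius_def fps_conv_radius_def conv_radius_nonneg intro: INF_greatest)

text \<open>By continuity and the constant term 1, there are no zeros near the origin.\<close>

lemma ene_radius_pos:
  assumes "fps_nth f 0 = 1" "0 < fps_conv_radius f"
  shows "0 < ene_radius f"
proof -
  have "isCont (eval_fps f) 0"
    using assms(2) by (intro continuous_eval_fps) (auto simp: zero_ereal_def)
  then have "(eval_fps f \<longlongrightarrow> eval_fps f 0) (nhds 0)"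
    by (simp add: continuous_at flip: tendsto_at_iff_tendsto_nhds)
  then have "eventually (\<lambda>z. eval_fps f z \<noteq> 0) (nhds 0)"
    by (rule tendsto_imp_eventually_ne) (simp add: eval_fps_at_0 assms(1))
  then obtain e where e: "0 < e" "\<And>z. norm z < e \<Longrightarrow> eval_fps f z \<noteq> 0"
    by (auto simp: eventually_nhds_metric)
  then have "ereal e \<le> (INF \<alpha> \<in> {\<alpha>. ereal (norm \<alpha>) < fps_conv_radius f \<and> eval_fps f \<alpha> = 0}. ereal (norm \<alpha>))"
    by (intro INF_greatest) (auto simp: not_less[symmetric])
  then have "0 < (INF \<alpha> \<in> {\<alpha>. ereal (norm \<alpha>) < fps_conv_radius f \<and> eval_fps f \<alpha> = 0}. ereal (norm \<alpha>))"
    by (rule less_le_trans[rotated]) (simp add: e(1))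
  then show ?thesis
    using assms(2) by (simp add: ene_radius_def)
qed

lemma eval_fps_nonzero_in_ene_radius:
  assumes "ereal (norm z) < ene_radius f"
  shows "eval_fps f z \<noteq> 0"
proof
  assume "eval_fps f z = 0"
  then have "ene_radius f \<le> ereal (norm z)"
    using assms unfolding ene_radius_def by (intro min.coboundedI2 INF_lower) simp
  then show False
    using assms by simp
qed

text \<open>Within \<open>ene_radius f\<close> the function has no zeros, so the series of its
  reciprocal converges there as well.\<close>

lemma fps_conv_radius_neg_log_deriv: "ene_radius f \<le> fps_conv_radius (neg_log_deriv f)"
proof -
  have le: "ene_radius f \<le> fps_conv_radius f"
    by (simp add: ene_radius_def)
  have "ene_radius f \<le> fps_conv_radius (fps_X * fps_deriv f)"
    using le fps_conv_radius_deriv[of f] fps_conv_radius_mult[of fps_X "fps_deriv f"] by simp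
  moreover have "ene_radius f \<le> fps_conv_radius (inverse f)"
    using fps_conv_radius_inverse[where f = f and r = "ene_radius f"] le
    by (simp add: eval_fps_nonzero_in_ene_radius)
  ultimately have "ene_radius f \<le> min (fps_conv_radius (- (fps_X * fps_deriv f))) (fps_conv_radius (inverse f))"
    by simp
  also have "\<dots> \<le> fps_conv_radius (neg_log_deriv f)"
    unfolding neg_log_deriv_def by (rule fps_conv_radius_mult)
  finally show ?thesis .
qed

theorem theorem8p1:
  fixes A :: "complex set" and f g :: "complex fps"
  assumes "complex_subring A" and "f \<in> unit_series A" and "g \<in> unit_series A"
  shows "fps_conv_radius (f \<star> g) \<ge> ene_radius f * ene_radius g \<and>
    (fps_conv_radius f > 0 \<and> fps_conv_radius g > 0 \<longrightarrow> fps_conv_radius (f \<star> g) > 0)"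
proof -
  have f0: "fps_nth f 0 = 1" and g0: "fps_nth g 0 = 1"
    using assms by (simp_all add: unit_series_def)
  have le: "ene_radius f * ene_radius g \<le> fps_conv_radius (f \<star> g)"
  \<comment> \<open>\<open>fps_exp_integral\<close> needs a positive radius. Otherwise the bound is
    0 and holds trivially; \<open>ereal\<close> shares the convention that zero times infinity is
    zero.\<close>
  proof (cases "0 < ene_radius f * ene_radius g")
    case True
    define u where "u = Abs_fps (\<lambda>k. fps_nth (neg_log_deriv f) k * fps_nth (neg_log_deriv g) k)"
    have "ene_radius f * ene_radius g \<le>
        fps_conv_radius (neg_log_deriv f) * fps_conv_radius (neg_log_deriv g)"
      by (intro ereal_mult_mono fps_conv_radius_neg_log_deriv ene_radius_nonneg
          order_trans[OF ene_radius_nonneg fps_conv_radius_neg_log_deriv])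
    also have "\<dots> \<le> fps_conv_radius u"
      using conv_radius_hadamard_ge by (simp add: fps_conv_radius_def u_def)
    finally have R: "ene_radius f * ene_radius g \<le> fps_conv_radius u" .
    have "fps_nth u 0 = 0"
      by (simp add: u_def neg_log_deriv_def)
    then obtain h where "fps_nth h 0 = 1" "u * h = - (fps_X * fps_deriv h)"
        "fps_conv_radius u \<le> fps_conv_radius h"
      using fps_exp_integral[of u] True R by (metis less_le_trans)
    then show ?thesis
      using ene_prod_eqI[OF f0 g0, of h] R by (simp add: u_def)
  next
    case False
    then show ?thesis
      by (metis conv_radius_nonneg fps_conv_radius_def not_less order_trans)
  qed
  moreover have "0 < fps_conv_radius (f \<star> g)" if "0 < fps_conv_radius f" "0 < fps_conv_radius g"
    using le ene_radius_pos[OF f0 that(1)] ene_radius_pos[OF g0 that(2)]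
    by (metis ereal_zero_less_0_iff less_le_trans)
  ultimately show ?thesis
    by blast
qed

end
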